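(* Let $\mathsf{C}$ be a category of groups with operations and let $G$ be an internal groupoid in $\mathsf{C}$. Then the category $\mathsf{Act}_{\mathsf{Cat}(\mathsf{C})}/G$ of internal groupoid actions of $G$ on groups with operations and the category $\mathsf{Cov}_{\mathsf{Cat}(\mathsf{C})}/G$ of covers of $G$ in the category $\mathsf{Cat}(\mathsf{C})$ of internal groupoids in $\mathsf{C}$ are equivalent.
   Context: Groupoids. A groupoid $G$ has a set of morphisms (called elements), also denoted $G$, a set of objects $G_0$, initial and final point maps $d_0,d_1\colon G\to G_0$, and an object inclusion $\epsilon\colon G_0\to G$. The composite $a\circ b$ is defined when $d_1(a)=d_0(b)$, and then $d_0(a\circ b)=d_0(a)$, $d_1(a\circ b)=d_1(b)$. $St_G x=\{a\in G: d_0(a)=x\}$ is the star of $x$. A morphism $p\colon\widetilde G\to G$ of groupoids is a covering morphism if for each $\tilde x\in\widetilde G_0$ the restriction $St_{\widetilde G}\tilde x\to St_G p(\tilde x)$ is bijective. An action of a groupoid $G$ on a set consists of a set $X$, a function $\theta\colon X\to G_0$ and a function $\varphi\colon X_\theta\times_{d_0}G\to X$, $(x,a)\mapsto xa$, on the pullback of $\theta$ and $d_0$, such that $\theta(xa)=d_1(a)$, $x(a\circ b)=(xa)b$ and $x\epsilon(\theta(x))=x$ whenever these are defined. Groups with operations. A category of groups with operations $\mathsf{C}$ is the category of groups equipped with a set of operations $\Omega$ satisfying a set of identities $\mathsf{E}$, where $\mathsf{E}$ includes the group laws and, with $\Omega_i$ the set of $i$-ary operations: (a) $\Omega=\Omega_0\cup\Omega_1\cup\Omega_2$;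 (b) the group operations, written additively (but not assumed commutative) $0,-,+$, are elements of $\Omega_0,\Omega_1,\Omega_2$ respectively; put $\Omega_2'=\Omega_2\setminus\{+\}$, $\Omega_1'=\Omega_1\setminus\{-\}$; if $\star\in\Omega_2'$ then $\star^\circ$, defined by $a\star^\circ b=b\star a$, is also in $\Omega_2'$; and $\Omega_0=\{0\}$; (c) for each $\star\in\Omega_2'$, $\mathsf{E}$ includes $a\star(b+c)=a\star b+a\star c$; (d) for each $\omega\in\Omega_1'$ and $\star\in\Omega_2'$, $\mathsf{E}$ includes $\omega(a+b)=\omega(a)+\omega(b)$ and $\omega(a)\star b=\omega(a\star b)$. Morphisms are group homomorphisms preserving the operations in $\Omega_1'$ and $\Omega_2'$. Objects of $\mathsf{C}$ are called groups with operations. Internal groupoids. An internal groupoid (equivalently, internal category) $G$ in $\mathsf{C}$ is a category (automatically a groupoid) in which $G$ and $G_0$ are objects of $\mathsf{C}$ and $d_0,d_1\colon G\to G_0$, $\epsilon\colon G_0\to G$ and the partial composition $\circ\colon G_{d_1}\times_{d_0}G\to G$ are morphisms in $\mathsf{C}$. A morphism in $\mathsf{Cat}(\mathsf{C})$ is a morphism of the underlying groupoids which is also a morphism in $\mathsf{C}$. A morphism of internal groupoids is a cover (covering morphism) if it is a covering morphism on the underlying groupoids. $\mathsf{Cov}_{\mathsf{Cat}(\mathsf{C})}/G$ has as objects the covering morphisms $p\colon\widetilde G\to G$ of internal groupoids, and as morphisms from $p\colon\widetilde G\to G$ to $q\colon\widetilde H\to G$ the morphisms $f\colon\widetilde G\to\widetilde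 H$ of internal groupoids which are also covering morphisms and satisfy $qf=p$. Internal actions. An internal groupoid $G$ in $\mathsf{C}$ acts on an object $X$ of $\mathsf{C}$ via $\theta$ if the underlying groupoid of $G$ acts on the underlying set of $X$ in such a way that $\theta\colon X\to G_0$ and $\varphi\colon X_\theta\times_{d_0}G\to X$ are morphisms in $\mathsf{C}$; the action is written $(X,\theta,\varphi)$. $\mathsf{Act}_{\mathsf{Cat}(\mathsf{C})}/G$ has these actions as objects, and as morphisms from $(X,\theta,\varphi)$ to $(Y,\theta',\varphi')$ the morphisms $f\colon X\to Y$ in $\mathsf{C}$ such that $\theta=\theta' f$ and $f(xa)=(fx)a$ whenever $xa$ is defined. *)

theory Defs
  imports Main "HOL-Library.FuncSet"
begin

section \<open>Categories and equivalence of categories\<close>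

text \<open>
  A category is given by its objects, hom-sets, identities and composition, where
  \<open>Cmp C x y z g f\<close> is the composite of \<open>f : x \<rightarrow> y\<close> followed by \<open>g : y \<rightarrow> z\<close>.
  Hom-sets need not be disjoint, so composition and the arrow part of a functor
  take the objects as arguments.
\<close>

record ('o, 'm) cat =
  Ob  :: "'o set"
  Hom :: "'o \<Rightarrow> 'o \<Rightarrow> 'm set"
  Idt :: "'o \<Rightarrow> 'm"
  Cmp :: "'o \<Rightarrow> 'o \<Rightarrow> 'o \<Rightarrow> 'm \<Rightarrow> 'm \<Rightarrow> 'm"

definition category :: "('o, 'm) cat \<Rightarrow> bool" where
  "category C \<longleftrightarrow>
     (\<forall>x\<in>Ob C. Idt C x \<in> Hom C x x) \<and>
     (\<forall>x\<in>Ob C. \<forall>y\<in>Ob C. \<forall>z\<in>Ob C. \<forall>f\<in>Hom C x y. \<forall>g\<in>Hom C y z.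
        Cmp C x y z g f \<in> Hom C x z) \<and>
     (\<forall>x\<in>Ob C. \<forall>y\<in>Ob C. \<forall>f\<in>Hom C x y.
        Cmp C x x y f (Idt C x) = f \<and> Cmp C x y y (Idt C y) f = f) \<and>
     (\<forall>w\<in>Ob C. \<forall>x\<in>Ob C. \<forall>y\<in>Ob C. \<forall>z\<in>Ob C.
        \<forall>f\<in>Hom C w x. \<forall>g\<in>Hom C x y. \<forall>h\<in>Hom C y z.
        Cmp C w y z h (Cmp C w x y g f) = Cmp C w x z (Cmp C x y z h g) f)"

definition iso_arrow :: "('o, 'm) cat \<Rightarrow> 'o \<Rightarrow> 'o \<Rightarrow> 'm \<Rightarrow> bool" where
  "iso_arrow C x y f \<longleftrightarrow> f \<in> Hom C x y \<and>
     (\<exists>g\<in>Hom C y x. Cmp C x y x g f = Idt C x \<and> Cmp C y x y f g = Idt C y)"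

definition is_functor ::
  "('o1, 'm1) cat \<Rightarrow> ('o2, 'm2) cat \<Rightarrow> ('o1 \<Rightarrow> 'o2) \<Rightarrow> ('o1 \<Rightarrow> 'o1 \<Rightarrow> 'm1 \<Rightarrow> 'm2) \<Rightarrow> bool" where
  "is_functor C D Fo Fm \<longleftrightarrow>
     (\<forall>x\<in>Ob C. Fo x \<in> Ob D) \<and>
     (\<forall>x\<in>Ob C. \<forall>y\<in>Ob C. \<forall>f\<in>Hom C x y. Fm x y f \<in> Hom D (Fo x) (Fo y)) \<and>
     (\<forall>x\<in>Ob C. Fm x x (Idt C x) = Idt D (Fo x)) \<and>
     (\<forall>x\<in>Ob C. \<forall>y\<in>Ob C. \<forall>z\<in>Ob C. \<forall>f\<in>Hom C x y. \<forall>g\<in>Hom C y z.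
        Fm x z (Cmp C x y z g f) = Cmp D (Fo x) (Fo y) (Fo z) (Fm y z g) (Fm x y f))"

definition natural_iso ::
  "('o1, 'm1) cat \<Rightarrow> ('o2, 'm2) cat
   \<Rightarrow> ('o1 \<Rightarrow> 'o2) \<Rightarrow> ('o1 \<Rightarrow> 'o1 \<Rightarrow> 'm1 \<Rightarrow> 'm2)
   \<Rightarrow> ('o1 \<Rightarrow> 'o2) \<Rightarrow> ('o1 \<Rightarrow> 'o1 \<Rightarrow> 'm1 \<Rightarrow> 'm2)
   \<Rightarrow> ('o1 \<Rightarrow> 'm2) \<Rightarrow> bool" where
  "natural_iso C D Fo Fm Go Gm t \<longleftrightarrow>
     (\<forall>x\<in>Ob C. iso_arrow D (Fo x) (Go x) (t x)) \<and>
     (\<forall>x\<in>Ob C. \<forall>y\<in>Ob C. \<forall>f\<in>Hom C x y.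
        Cmp D (Fo x) (Fo y) (Go y) (t y) (Fm x y f) =
        Cmp D (Fo x) (Go x) (Go y) (Gm x y f) (t x))"

definition equivalent_categories :: "('o1, 'm1) cat \<Rightarrow> ('o2, 'm2) cat \<Rightarrow> bool" where
  "equivalent_categories C D \<longleftrightarrow> category C \<and> category D \<and>
     (\<exists>Fo Fm Go Gm.
        is_functor C D Fo Fm \<and> is_functor D C Go Gm \<and>
        (\<exists>t. natural_iso C C
               (\<lambda>x. x) (\<lambda>x y f. f)
               (\<lambda>x. Go (Fo x)) (\<lambda>x y f. Gm (Fo x) (Fo y) (Fm x y f)) t) \<and>
        (\<exists>s. natural_iso D D
               (\<lambda>x. Fo (Go x)) (\<lambda>x y f. Fm (Go x) (Go y) (Gm x y f))
               (\<lambda>x. x) (\<lambda>x y f. f) s))"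


section \<open>Groups with operations\<close>

datatype 'f trm = Var nat | Op0 'f | Op1 'f "'f trm" | Op2 'f "'f trm" "'f trm"

text \<open>A category of groups with operations is presented by \<open>\<Omega> = \<Omega>\<^sub>0 \<union> \<Omega>\<^sub>1 \<union> \<Omega>\<^sub>2\<close>, with
  distinguished symbols for \<open>0, -, +\<close>, and a set of identities between terms over \<open>\<Omega>\<close>.\<close>

record 'f presentation =
  Om0  :: "'f set"
  Om1  :: "'f set"
  Om2  :: "'f set"
  zero_sym :: 'f
  neg_sym  :: 'f
  plus_sym :: 'f
  Eqs  :: "('f trm \<times> 'f trm) set"

definition Om1' :: "'f presentation \<Rightarrow> 'f set" where
  "Om1' T = Om1 T - {neg_sym T}"

definition Om2' :: "'f presentation \<Rightarrow> 'f set" where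
  "Om2' T = Om2 T - {plus_sym T}"

fun trm_over :: "'f presentation \<Rightarrow> 'f trm \<Rightarrow> bool" where
  "trm_over T (Var i) = True"
| "trm_over T (Op0 c) = (c \<in> Om0 T)"
| "trm_over T (Op1 w s) = (w \<in> Om1 T \<and> trm_over T s)"
| "trm_over T (Op2 m s t) = (m \<in> Om2 T \<and> trm_over T s \<and> trm_over T t)"

definition group_laws :: "'f presentation \<Rightarrow> ('f trm \<times> 'f trm) set" where
  "group_laws T =
    (let x = Var 0; y = Var 1; z = Var 2;
         o' = Op0 (zero_sym T); n = Op1 (neg_sym T); p = Op2 (plus_sym T)
     in {(p (p x y) z, p x (p y z)),
         (p o' x, x), (p x o', x),
         (p (n x) x, o'), (p x (n x), o')})"

definition groups_with_operations :: "'f presentation \<Rightarrow> bool" where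
  "groups_with_operations T \<longleftrightarrow>
     Om0 T = {zero_sym T} \<and> neg_sym T \<in> Om1 T \<and> plus_sym T \<in> Om2 T \<and>
     (\<forall>(s, t)\<in>Eqs T. trm_over T s \<and> trm_over T t) \<and>
     group_laws T \<subseteq> Eqs T \<and>
     (\<forall>m\<in>Om2' T. \<exists>m'\<in>Om2' T. (Op2 m' (Var 0) (Var 1), Op2 m (Var 1) (Var 0)) \<in> Eqs T) \<and>
     (\<forall>m\<in>Om2' T.
        (Op2 m (Var 0) (Op2 (plus_sym T) (Var 1) (Var 2)),
         Op2 (plus_sym T) (Op2 m (Var 0) (Var 1)) (Op2 m (Var 0) (Var 2))) \<in> Eqs T) \<and>
     (\<forall>w\<in>Om1' T.
        (Op1 w (Op2 (plus_sym T) (Var 0) (Var 1)),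
         Op2 (plus_sym T) (Op1 w (Var 0)) (Op1 w (Var 1))) \<in> Eqs T) \<and>
     (\<forall>w\<in>Om1' T. \<forall>m\<in>Om2' T.
        (Op2 m (Op1 w (Var 0)) (Var 1), Op1 w (Op2 m (Var 0) (Var 1))) \<in> Eqs T)"

text \<open>As usual for carrier-based structures, the values of operations and structure maps
  off their carriers are irrelevant; no condition is imposed on them.\<close>

record ('f, 'a) algebra =
  carr :: "'a set"
  op0  :: "'f \<Rightarrow> 'a"
  op1  :: "'f \<Rightarrow> 'a \<Rightarrow> 'a"
  op2  :: "'f \<Rightarrow> 'a \<Rightarrow> 'a \<Rightarrow> 'a"

fun trm_val :: "('f, 'a) algebra \<Rightarrow> (nat \<Rightarrow> 'a) \<Rightarrow> 'f trm \<Rightarrow> 'a" where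
  "trm_val A v (Var i) = v i"
| "trm_val A v (Op0 c) = op0 A c"
| "trm_val A v (Op1 w s) = op1 A w (trm_val A v s)"
| "trm_val A v (Op2 m s t) = op2 A m (trm_val A v s) (trm_val A v t)"

definition C_object :: "'f presentation \<Rightarrow> ('f, 'a) algebra \<Rightarrow> bool" where
  "C_object T A \<longleftrightarrow>
     (\<forall>c\<in>Om0 T. op0 A c \<in> carr A) \<and>
     (\<forall>w\<in>Om1 T. \<forall>a\<in>carr A. op1 A w a \<in> carr A) \<and>
     (\<forall>m\<in>Om2 T. \<forall>a\<in>carr A. \<forall>b\<in>carr A. op2 A m a b \<in> carr A) \<and>
     (\<forall>(s, t)\<in>Eqs T. \<forall>v. range v \<subseteq> carr A \<longrightarrow> trm_val A v s = trm_val A v t)"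

definition C_morphism ::
  "'f presentation \<Rightarrow> ('f, 'a) algebra \<Rightarrow> ('f, 'b) algebra \<Rightarrow> ('a \<Rightarrow> 'b) \<Rightarrow> bool" where
  "C_morphism T A B f \<longleftrightarrow>
     f \<in> carr A \<rightarrow> carr B \<and>
     (\<forall>a\<in>carr A. \<forall>b\<in>carr A.
        f (op2 A (plus_sym T) a b) = op2 B (plus_sym T) (f a) (f b)) \<and>
     (\<forall>w\<in>Om1' T. \<forall>a\<in>carr A. f (op1 A w a) = op1 B w (f a)) \<and>
     (\<forall>m\<in>Om2' T. \<forall>a\<in>carr A. \<forall>b\<in>carr A. f (op2 A m a b) = op2 B m (f a) (f b))"

definition pullback ::
  "('f, 'a) algebra \<Rightarrow> ('a \<Rightarrow> 'c) \<Rightarrow> ('f, 'b) algebra \<Rightarrow> ('b \<Rightarrow> 'c) \<Rightarrow> ('f, 'a \<times> 'b) algebra" where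
  "pullback A f B g =
     \<lparr> carr = {(a, b). a \<in> carr A \<and> b \<in> carr B \<and> f a = g b},
       op0 = (\<lambda>c. (op0 A c, op0 B c)),
       op1 = (\<lambda>w (a, b). (op1 A w a, op1 B w b)),
       op2 = (\<lambda>m (a, b) (a', b'). (op2 A m a a', op2 B m b b')) \<rparr>"


section \<open>Groupoids, covering morphisms, actions\<close>

text \<open>Composition is in diagrammatic order: \<open>comp G a b\<close> is \<open>a \<circ> b\<close>, defined when
  \<open>d1 G a = d0 G b\<close>.\<close>

record 'u groupoid =
  elts :: "'u set"
  objs :: "'u set"
  d0   :: "'u \<Rightarrow> 'u"
  d1   :: "'u \<Rightarrow> 'u"
  eps  :: "'u \<Rightarrow> 'u"
  comp :: "'u \<Rightarrow> 'u \<Rightarrow> 'u"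

definition is_groupoid :: "('u, 'z) groupoid_scheme \<Rightarrow> bool" where
  "is_groupoid G \<longleftrightarrow>
     d0 G \<in> elts G \<rightarrow> objs G \<and> d1 G \<in> elts G \<rightarrow> objs G \<and> eps G \<in> objs G \<rightarrow> elts G \<and>
     (\<forall>x\<in>objs G. d0 G (eps G x) = x \<and> d1 G (eps G x) = x) \<and>
     (\<forall>a\<in>elts G. \<forall>b\<in>elts G. d1 G a = d0 G b \<longrightarrow>
        comp G a b \<in> elts G \<and> d0 G (comp G a b) = d0 G a \<and> d1 G (comp G a b) = d1 G b) \<and>
     (\<forall>a\<in>elts G. \<forall>b\<in>elts G. \<forall>c\<in>elts G. d1 G a = d0 G b \<longrightarrow> d1 G b = d0 G c \<longrightarrow>
        comp G (comp G a b) c = comp G a (comp G b c)) \<and>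
     (\<forall>a\<in>elts G. comp G (eps G (d0 G a)) a = a \<and> comp G a (eps G (d1 G a)) = a) \<and>
     (\<forall>a\<in>elts G. \<exists>b\<in>elts G. d0 G b = d1 G a \<and> d1 G b = d0 G a \<and>
        comp G a b = eps G (d0 G a) \<and> comp G b a = eps G (d1 G a))"

definition St :: "('u, 'z) groupoid_scheme \<Rightarrow> 'u \<Rightarrow> 'u set" where
  "St G x = {a \<in> elts G. d0 G a = x}"

text \<open>A morphism of groupoids is a pair: its map on elements and its map on objects.\<close>

type_synonym 'u gmap = "('u \<Rightarrow> 'u) \<times> ('u \<Rightarrow> 'u)"

definition groupoid_morphism ::
  "('u, 'y) groupoid_scheme \<Rightarrow> ('u, 'z) groupoid_scheme \<Rightarrow> 'u gmap \<Rightarrow> bool" where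
  "groupoid_morphism H G p \<longleftrightarrow>
     fst p \<in> elts H \<rightarrow> elts G \<and> snd p \<in> objs H \<rightarrow> objs G \<and>
     (\<forall>a\<in>elts H. d0 G (fst p a) = snd p (d0 H a) \<and> d1 G (fst p a) = snd p (d1 H a)) \<and>
     (\<forall>x\<in>objs H. fst p (eps H x) = eps G (snd p x)) \<and>
     (\<forall>a\<in>elts H. \<forall>b\<in>elts H. d1 H a = d0 H b \<longrightarrow>
        fst p (comp H a b) = comp G (fst p a) (fst p b))"

definition covering_morphism ::
  "('u, 'y) groupoid_scheme \<Rightarrow> ('u, 'z) groupoid_scheme \<Rightarrow> 'u gmap \<Rightarrow> bool" where
  "covering_morphism H G p \<longleftrightarrow> groupoid_morphism H G p \<and>
     (\<forall>x\<in>objs H. bij_betw (fst p) (St H x) (St G (snd p x)))"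

definition groupoid_action ::
  "('u, 'z) groupoid_scheme \<Rightarrow> 'u set \<Rightarrow> ('u \<Rightarrow> 'u) \<Rightarrow> ('u \<Rightarrow> 'u \<Rightarrow> 'u) \<Rightarrow> bool" where
  "groupoid_action G X th ph \<longleftrightarrow>
     th \<in> X \<rightarrow> objs G \<and>
     (\<forall>x\<in>X. \<forall>a\<in>elts G. th x = d0 G a \<longrightarrow> ph x a \<in> X \<and> th (ph x a) = d1 G a) \<and>
     (\<forall>x\<in>X. \<forall>a\<in>elts G. \<forall>b\<in>elts G. th x = d0 G a \<longrightarrow> d1 G a = d0 G b \<longrightarrow>
        ph x (comp G a b) = ph (ph x a) b) \<and>
     (\<forall>x\<in>X. ph x (eps G (th x)) = x)"


section \<open>Internal groupoids in \<open>C\<close>, their covers and their actions\<close>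

record ('u, 'f) igroupoid = "'u groupoid" +
  elt_alg :: "('f, 'u) algebra"
  obj_alg :: "('f, 'u) algebra"

definition internal_groupoid :: "'f presentation \<Rightarrow> ('u, 'f) igroupoid \<Rightarrow> bool" where
  "internal_groupoid T G \<longleftrightarrow>
     is_groupoid G \<and>
     carr (elt_alg G) = elts G \<and> C_object T (elt_alg G) \<and>
     carr (obj_alg G) = objs G \<and> C_object T (obj_alg G) \<and>
     C_morphism T (elt_alg G) (obj_alg G) (d0 G) \<and>
     C_morphism T (elt_alg G) (obj_alg G) (d1 G) \<and>
     C_morphism T (obj_alg G) (elt_alg G) (eps G) \<and>
     C_morphism T (pullback (elt_alg G) (d1 G) (elt_alg G) (d0 G)) (elt_alg G)
       (\<lambda>(a, b). comp G a b)"

definition internal_morphism ::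
  "'f presentation \<Rightarrow> ('u, 'f) igroupoid \<Rightarrow> ('u, 'f) igroupoid \<Rightarrow> 'u gmap \<Rightarrow> bool" where
  "internal_morphism T H G p \<longleftrightarrow> groupoid_morphism H G p \<and>
     C_morphism T (elt_alg H) (elt_alg G) (fst p) \<and>
     C_morphism T (obj_alg H) (obj_alg G) (snd p)"

definition internal_cover ::
  "'f presentation \<Rightarrow> ('u, 'f) igroupoid \<Rightarrow> ('u, 'f) igroupoid \<Rightarrow> 'u gmap \<Rightarrow> bool" where
  "internal_cover T H G p \<longleftrightarrow> internal_morphism T H G p \<and> covering_morphism H G p"

text \<open>In the categories below, the universe of sets is the collection of subsets of the
  type \<open>'u\<close>; when \<open>'u\<close> is infinite it is closed under binary products up to bijection,
  which the cover associated with an action requires. Arrows are functions that are \<open>undefined\<close> off their domain, so that equality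
  of arrows is equality of functions.\<close>

record ('u, 'f) cover =
  ctotal :: "('u, 'f) igroupoid"
  cmap   :: "'u gmap"

definition Cov :: "'f presentation \<Rightarrow> ('u, 'f) igroupoid \<Rightarrow> (('u, 'f) cover, 'u gmap) cat" where
  "Cov T G =
     \<lparr> Ob = {P. internal_groupoid T (ctotal P) \<and> internal_cover T (ctotal P) G (cmap P)},
       Hom = (\<lambda>P Q. {f. internal_cover T (ctotal P) (ctotal Q) f \<and>
                fst f \<in> extensional (elts (ctotal P)) \<and>
                snd f \<in> extensional (objs (ctotal P)) \<and>
                (\<forall>a\<in>elts (ctotal P). fst (cmap Q) (fst f a) = fst (cmap P) a) \<and>
                (\<forall>x\<in>objs (ctotal P). snd (cmap Q) (snd f x) = snd (cmap P) x)}),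
       Idt = (\<lambda>P. (restrict (\<lambda>a. a) (elts (ctotal P)), restrict (\<lambda>x. x) (objs (ctotal P)))),
       Cmp = (\<lambda>P Q R g f. (compose (elts (ctotal P)) (fst g) (fst f),
                           compose (objs (ctotal P)) (snd g) (snd f))) \<rparr>"

record ('u, 'f) action =
  aobj   :: "('f, 'u) algebra"
  atheta :: "'u \<Rightarrow> 'u"
  aphi   :: "'u \<Rightarrow> 'u \<Rightarrow> 'u"

definition internal_action ::
  "'f presentation \<Rightarrow> ('u, 'f) igroupoid \<Rightarrow> ('u, 'f) action \<Rightarrow> bool" where
  "internal_action T G X \<longleftrightarrow>
     C_object T (aobj X) \<and>
     groupoid_action G (carr (aobj X)) (atheta X) (aphi X) \<and>
     C_morphism T (aobj X) (obj_alg G) (atheta X) \<and>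
     C_morphism T (pullback (aobj X) (atheta X) (elt_alg G) (d0 G)) (aobj X)
       (\<lambda>(x, a). aphi X x a)"

definition Act :: "'f presentation \<Rightarrow> ('u, 'f) igroupoid \<Rightarrow> (('u, 'f) action, 'u \<Rightarrow> 'u) cat" where
  "Act T G =
     \<lparr> Ob = {X. internal_action T G X},
       Hom = (\<lambda>X Y. {f. C_morphism T (aobj X) (aobj Y) f \<and>
                f \<in> extensional (carr (aobj X)) \<and>
                (\<forall>x\<in>carr (aobj X). atheta X x = atheta Y (f x)) \<and>
                (\<forall>x\<in>carr (aobj X). \<forall>a\<in>elts G. atheta X x = d0 G a \<longrightarrow>
                   f (aphi X x a) = aphi Y (f x) a)}),
       Idt = (\<lambda>X. restrict (\<lambda>x. x) (carr (aobj X))),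
       Cmp = (\<lambda>X Y Z g f. compose (carr (aobj X)) g f) \<rparr>"

end

theory Submission
  imports Defs
begin

text \<open>
  For plain groupoids the equivalence is classical. A covering \<open>p : H \<rightarrow> G\<close> lets \<open>G\<close> act on the
  objects of \<open>H\<close>: every \<open>a\<close> in \<open>G\<close> starting at \<open>p x\<close> has a unique lift starting at \<open>x\<close>, and \<open>x a\<close>
  is the end point of that lift. Conversely an action of \<open>G\<close> on \<open>X\<close> via \<open>\<theta>\<close> gives the action
  groupoid, whose elements are the pairs \<open>(x, a)\<close> with \<open>\<theta> x = d\<^sub>0 a\<close>, running from \<open>x\<close> to \<open>x a\<close>;
  the projection to \<open>G\<close> covers \<open>G\<close> because an element of the star of \<open>x\<close> is determined by \<open>a\<close>.

  The algebra comes along for two reasons. The elements of the action groupoid form a pullback of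
  \<open>\<theta>\<close> and \<open>d\<^sub>0\<close>, and pullbacks of groups with operations are computed componentwise, so all
  identities and all homomorphism conditions are inherited from \<open>X\<close> and \<open>G\<close>
  (\<open>C_object_pullback_code\<close>, \<open>cover_of_action_Ob\<close>). In the other direction, applying an operation
  to lifts of \<open>a\<close> and \<open>b\<close> yields a lift of the operation applied to \<open>a\<close> and \<open>b\<close>, with the right
  source; since lifts are unique, lifting is a homomorphism, and so is the action obtained from it
  (\<open>action_of_cover_Ob\<close>). The same uniqueness argument shows that a map between covers over \<open>G\<close>
  is a morphism of covers as soon as it respects sources and targets and is a homomorphism on
  objects (\<open>cover_mapI\<close>).

  Starting from an action, the two constructions return the action itself, up to values that the
  action map takes outside its domain, so identity maps form the unit. Starting from a cover \<open>H\<close>,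
  the bijection \<open>e \<mapsto> (d\<^sub>0 e, p e)\<close> identifies \<open>H\<close> with the action groupoid; its inverse is
  \<open>(x, a) \<mapsto> lift of a at x\<close>, and \<open>cover_mapI\<close> applies to both (\<open>counit_iso\<close>).

  The elements of every groupoid in sight are drawn from one type \<open>'u\<close>, so pairs have to be coded
  as elements of \<open>'u\<close>. This is where \<open>'u\<close> being infinite enters: it makes \<open>'u \<times> 'u\<close> and \<open>'u\<close>
  equinumerous.
\<close>

section \<open>Morphisms of groups with operations\<close>

lemma plus_sym_in_Om2: "groups_with_operations T \<Longrightarrow> plus_sym T \<in> Om2 T"
  and neg_sym_in_Om1: "groups_with_operations T \<Longrightarrow> neg_sym T \<in> Om1 T"
  and Om0_eq: "groups_with_operations T \<Longrightarrow> Om0 T = {zero_sym T}"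
  and group_laws_in_Eqs: "groups_with_operations T \<Longrightarrow> group_laws T \<subseteq> Eqs T"
  by (auto simp: groups_with_operations_def)

lemma C_object_closed:
  assumes "C_object T A"
  shows "c \<in> Om0 T \<Longrightarrow> op0 A c \<in> carr A"
    and "w \<in> Om1 T \<Longrightarrow> a \<in> carr A \<Longrightarrow> op1 A w a \<in> carr A"
    and "m \<in> Om2 T \<Longrightarrow> a \<in> carr A \<Longrightarrow> b \<in> carr A \<Longrightarrow> op2 A m a b \<in> carr A"
  using assms by (auto simp: C_object_def)

lemma C_object_identity:
  assumes "C_object T A" "(s, t) \<in> Eqs T" "range v \<subseteq> carr A"
  shows "trm_val A v s = trm_val A v t"
  using assms by (auto simp: C_object_def)

text \<open>The group laws are given as identities between terms over the variables 0, 1, 2;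
  evaluating them at \<open>x, y, z\<close> makes them usable as equations on the carrier.\<close>

lemma C_object_group:
  assumes C: "groups_with_operations T" and A: "C_object T A"
    and x: "x \<in> carr A" and y: "y \<in> carr A" and z: "z \<in> carr A"
  defines "p \<equiv> op2 A (plus_sym T)" and "n \<equiv> op1 A (neg_sym T)" and "o' \<equiv> op0 A (zero_sym T)"
  shows "p (p x y) z = p x (p y z)" and "p o' x = x" and "p x o' = x"
    and "p (n x) x = o'" and "p x (n x) = o'"
proof -
  define v where "v = (\<lambda>i::nat. if i = 0 then x else if i = 1 then y else z)"
  have v: "range v \<subseteq> carr A"
    using x y z by (auto simp: v_def)
  have law: "trm_val A v s = trm_val A v t" if "(s, t) \<in> group_laws T" for s t
    using C_object_identity[OF A _ v] group_laws_in_Eqs[OF C] that by blast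
  show "p (p x y) z = p x (p y z)" and "p o' x = x" and "p x o' = x"
    and "p (n x) x = o'" and "p x (n x) = o'"
    using law unfolding group_laws_def Let_def p_def n_def o'_def
    by (fastforce simp: v_def)+
qed

text \<open>Addition needs no separate treatment once it is counted among all binary operations.\<close>

lemma C_morphism_iff:
  assumes "groups_with_operations T"
  shows "C_morphism T A B f \<longleftrightarrow> f \<in> carr A \<rightarrow> carr B \<and>
     (\<forall>w\<in>Om1' T. \<forall>a\<in>carr A. f (op1 A w a) = op1 B w (f a)) \<and>
     (\<forall>m\<in>Om2 T. \<forall>a\<in>carr A. \<forall>b\<in>carr A. f (op2 A m a b) = op2 B m (f a) (f b))"
  using plus_sym_in_Om2[OF assms] unfolding C_morphism_def Om2'_def by blast

lemma C_morphism_in: "C_morphism T A B f \<Longrightarrow> a \<in> carr A \<Longrightarrow> f a \<in> carr B"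
  by (auto simp: C_morphism_def)

text \<open>Morphisms are only asked to respect addition and the operations other than negation.
  As for groups, they then also respect zero, the only idempotent element, and negation.\<close>

lemma C_morphism_preserves:
  assumes C: "groups_with_operations T" and A: "C_object T A" and B: "C_object T B"
    and f: "C_morphism T A B f"
  shows "c \<in> Om0 T \<Longrightarrow> f (op0 A c) = op0 B c"
    and "w \<in> Om1 T \<Longrightarrow> a \<in> carr A \<Longrightarrow> f (op1 A w a) = op1 B w (f a)"
    and "m \<in> Om2 T \<Longrightarrow> a \<in> carr A \<Longrightarrow> b \<in> carr A \<Longrightarrow> f (op2 A m a b) = op2 B m (f a) (f b)"
proof -
  note grpA = C_object_group[OF C A] and grpB = C_object_group[OF C B]
  note clA = C_object_closed[OF A] and clB = C_object_closed[OF B]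
  let ?p = "op2 B (plus_sym T)" and ?n = "op1 B (neg_sym T)" and ?o = "op0 B (zero_sym T)"
  let ?z = "op0 A (zero_sym T)"
  have in_B: "f a \<in> carr B" if "a \<in> carr A" for a
    using f that by (auto simp: C_morphism_def)
  have add: "f (op2 A (plus_sym T) a b) = ?p (f a) (f b)" if "a \<in> carr A" "b \<in> carr A" for a b
    using f that by (auto simp: C_morphism_def)
  have z: "?z \<in> carr A"
    using clA(1) Om0_eq[OF C] by auto
  have n_in: "op1 A (neg_sym T) a \<in> carr A" if "a \<in> carr A" for a
    using clA(2) neg_sym_in_Om1[OF C] that by auto
  have nB_in: "?n b \<in> carr B" if "b \<in> carr B" for b
    using clB(2) neg_sym_in_Om1[OF C] that by auto
  \<comment> \<open>Left cancellation in \<open>B\<close>, in the form: the solution of \<open>c + b = d\<close> is \<open>-c + d\<close>.\<close>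
  have cancel: "b = ?p (?n c) d" if "b \<in> carr B" "c \<in> carr B" "?p c b = d" for b c d
    using that grpB nB_in by metis
  have zero: "f ?z = ?o"
  proof -
    have "?p (f ?z) (f ?z) = f ?z"
      using add[OF z z] grpA(2)[OF z z z] by simp
    then have "f ?z = ?p (?n (f ?z)) (f ?z)"
      using cancel in_B[OF z] by blast
    then show ?thesis
      using grpB(4) in_B[OF z] by metis
  qed
  show "c \<in> Om0 T \<Longrightarrow> f (op0 A c) = op0 B c"
    using zero Om0_eq[OF C] by simp
  show "f (op1 A w a) = op1 B w (f a)" if w: "w \<in> Om1 T" and a: "a \<in> carr A"
  proof (cases "w = neg_sym T")
    case True
    have "?p (f a) (f (op1 A w a)) = ?o"
      using add[OF a n_in[OF a]] grpA(5)[OF a a a] zero True by simp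
    then have "f (op1 A w a) = ?p (?n (f a)) ?o"
      using cancel in_B a n_in True by blast
    then show ?thesis
      using grpB(3) nB_in in_B[OF a] True by metis
  next
    case False
    then show ?thesis
      using f w a by (auto simp: C_morphism_def Om1'_def)
  qed
  show "m \<in> Om2 T \<Longrightarrow> a \<in> carr A \<Longrightarrow> b \<in> carr A \<Longrightarrow> f (op2 A m a b) = op2 B m (f a) (f b)"
    using f by (auto simp: C_morphism_iff[OF C])
qed

lemma C_morphism_id: "C_morphism T A A (restrict (\<lambda>x. x) (carr A))"
  if "groups_with_operations T" "C_object T A"
  using that C_object_closed[OF that(2)] by (auto simp: C_morphism_iff Om1'_def)

lemma C_morphism_compose:
  assumes "groups_with_operations T" "C_object T A" "C_morphism T A B f" "C_morphism T B D g"
  shows "C_morphism T A D (compose (carr A) g f)"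
  using assms(3,4) C_object_closed[OF assms(2)]
  by (auto simp: C_morphism_iff[OF assms(1)] compose_def Om1'_def Pi_iff)

section \<open>Structure maps of internal groupoids and actions\<close>

lemma internal_groupoidD:
  assumes "internal_groupoid T G"
  shows "is_groupoid G" "carr (elt_alg G) = elts G" "C_object T (elt_alg G)"
    "carr (obj_alg G) = objs G" "C_object T (obj_alg G)"
    "C_morphism T (elt_alg G) (obj_alg G) (d0 G)"
    "C_morphism T (elt_alg G) (obj_alg G) (d1 G)"
    "C_morphism T (obj_alg G) (elt_alg G) (eps G)"
    "C_morphism T (pullback (elt_alg G) (d1 G) (elt_alg G) (d0 G)) (elt_alg G)
       (\<lambda>(a, b). comp G a b)"
  using assms by (auto simp: internal_groupoid_def)

lemma groupoidD:
  assumes "is_groupoid G"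
  shows "a \<in> elts G \<Longrightarrow> d0 G a \<in> objs G" "a \<in> elts G \<Longrightarrow> d1 G a \<in> objs G"
    "x \<in> objs G \<Longrightarrow> eps G x \<in> elts G" "x \<in> objs G \<Longrightarrow> d0 G (eps G x) = x"
    "x \<in> objs G \<Longrightarrow> d1 G (eps G x) = x"
    "a \<in> elts G \<Longrightarrow> b \<in> elts G \<Longrightarrow> d1 G a = d0 G b \<Longrightarrow> comp G a b \<in> elts G"
    "a \<in> elts G \<Longrightarrow> b \<in> elts G \<Longrightarrow> d1 G a = d0 G b \<Longrightarrow> d0 G (comp G a b) = d0 G a"
    "a \<in> elts G \<Longrightarrow> b \<in> elts G \<Longrightarrow> d1 G a = d0 G b \<Longrightarrow> d1 G (comp G a b) = d1 G b"
    "a \<in> elts G \<Longrightarrow> b \<in> elts G \<Longrightarrow> c \<in> elts G \<Longrightarrow> d1 G a = d0 G b \<Longrightarrow> d1 G b = d0 G c \<Longrightarrow>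
        comp G (comp G a b) c = comp G a (comp G b c)"
    "a \<in> elts G \<Longrightarrow> comp G (eps G (d0 G a)) a = a"
    "a \<in> elts G \<Longrightarrow> comp G a (eps G (d1 G a)) = a"
    "a \<in> elts G \<Longrightarrow> \<exists>b\<in>elts G. d0 G b = d1 G a \<and> d1 G b = d0 G a \<and>
        comp G a b = eps G (d0 G a) \<and> comp G b a = eps G (d1 G a)"
  using assms unfolding is_groupoid_def by (blast | simp add: Pi_iff)+

lemma groupoid_actionD:
  assumes "groupoid_action G X th ph"
  shows "x \<in> X \<Longrightarrow> th x \<in> objs G"
    "x \<in> X \<Longrightarrow> a \<in> elts G \<Longrightarrow> th x = d0 G a \<Longrightarrow> ph x a \<in> X"
    "x \<in> X \<Longrightarrow> a \<in> elts G \<Longrightarrow> th x = d0 G a \<Longrightarrow> th (ph x a) = d1 G a"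
    "x \<in> X \<Longrightarrow> a \<in> elts G \<Longrightarrow> b \<in> elts G \<Longrightarrow> th x = d0 G a \<Longrightarrow> d1 G a = d0 G b \<Longrightarrow>
      ph x (comp G a b) = ph (ph x a) b"
    "x \<in> X \<Longrightarrow> ph x (eps G (th x)) = x"
  using assms unfolding groupoid_action_def by (auto simp: Pi_iff)

text \<open>Composition and action maps are homomorphisms on pullbacks. These two rules pass between that
  condition and the interchange laws, such as
  \<open>(a + a') \<circ> (b + b') = (a \<circ> b) + (a' \<circ> b')\<close>, which are what calculations use.\<close>

lemma C_morphism_pullbackD:
  assumes "groups_with_operations T" "C_morphism T (pullback A f B g) D (\<lambda>(a, b). h a b)"
    and "a \<in> carr A" "b \<in> carr B" "f a = g b"
  shows "w \<in> Om1' T \<Longrightarrow> h (op1 A w a) (op1 B w b) = op1 D w (h a b)"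
    and "m \<in> Om2 T \<Longrightarrow> a' \<in> carr A \<Longrightarrow> b' \<in> carr B \<Longrightarrow> f a' = g b' \<Longrightarrow>
      h (op2 A m a a') (op2 B m b b') = op2 D m (h a b) (h a' b')"
  using assms(2-) unfolding C_morphism_iff[OF assms(1)] by (auto simp: pullback_def)

lemma C_morphism_pullbackI:
  assumes "groups_with_operations T"
    and "\<And>a b. a \<in> carr A \<Longrightarrow> b \<in> carr B \<Longrightarrow> f a = g b \<Longrightarrow> h a b \<in> carr D"
    and "\<And>a b w. a \<in> carr A \<Longrightarrow> b \<in> carr B \<Longrightarrow> f a = g b \<Longrightarrow> w \<in> Om1' T \<Longrightarrow>
      h (op1 A w a) (op1 B w b) = op1 D w (h a b)"
    and "\<And>a b a' b' m. a \<in> carr A \<Longrightarrow> b \<in> carr B \<Longrightarrow> f a = g b \<Longrightarrow> m \<in> Om2 T \<Longrightarrow>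
      a' \<in> carr A \<Longrightarrow> b' \<in> carr B \<Longrightarrow> f a' = g b' \<Longrightarrow>
      h (op2 A m a a') (op2 B m b b') = op2 D m (h a b) (h a' b')"
  shows "C_morphism T (pullback A f B g) D (\<lambda>(a, b). h a b)"
  unfolding C_morphism_iff[OF assms(1)] using assms(2-) by (auto simp: pullback_def)

section \<open>The category of actions\<close>

lemma category_Act:
  assumes C: "groups_with_operations T"
  shows "category (Act T G)"
proof -
  have obj: "C_object T (aobj X)" and act: "groupoid_action G (carr (aobj X)) (atheta X) (aphi X)"
    if "internal_action T G X" for X
    using that by (auto simp: internal_action_def)
  show ?thesis
    unfolding category_def
  proof (intro conjI ballI, goal_cases)
    case (1 X)
    then show ?case
      by (auto simp: Act_def C_morphism_id[OF C obj] groupoid_actionD(2)[OF act])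
  next
    case (2 X Y Z f g)
    then show ?case
      by (auto simp: Act_def C_morphism_compose[OF C obj] compose_eq C_morphism_in
          groupoid_actionD(2)[OF act])
  qed (auto simp: Act_def compose_def fun_eq_iff extensional_def C_morphism_in)
qed

section \<open>The category of covers\<close>

lemma groupoid_morphismD:
  assumes "groupoid_morphism H G p"
  shows "a \<in> elts H \<Longrightarrow> fst p a \<in> elts G" "x \<in> objs H \<Longrightarrow> snd p x \<in> objs G"
    "a \<in> elts H \<Longrightarrow> d0 G (fst p a) = snd p (d0 H a)"
    "a \<in> elts H \<Longrightarrow> d1 G (fst p a) = snd p (d1 H a)"
    "x \<in> objs H \<Longrightarrow> fst p (eps H x) = eps G (snd p x)"
    "a \<in> elts H \<Longrightarrow> b \<in> elts H \<Longrightarrow> d1 H a = d0 H b \<Longrightarrow>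
        fst p (comp H a b) = comp G (fst p a) (fst p b)"
  using assms by (auto simp: groupoid_morphism_def)

lemma covering_morphism_id:
  assumes "is_groupoid H"
  shows "covering_morphism H H (restrict (\<lambda>a. a) (elts H), restrict (\<lambda>x. x) (objs H))"
proof -
  have "bij_betw (restrict (\<lambda>a. a) (elts H)) (St H x) (St H x)" for x
    by (auto simp: bij_betw_def inj_on_def St_def image_def)
  then show ?thesis
    using groupoidD[OF assms] by (auto simp: covering_morphism_def groupoid_morphism_def)
qed

lemma covering_morphism_compose:
  assumes H: "is_groupoid H" and f: "covering_morphism H K f" and g: "covering_morphism K L g"
  shows "covering_morphism H L (compose (elts H) (fst g) (fst f), compose (objs H) (snd g) (snd f))"
proof -
  note fD = groupoid_morphismD[OF f[unfolded covering_morphism_def, THEN conjunct1]]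
  note gD = groupoid_morphismD[OF g[unfolded covering_morphism_def, THEN conjunct1]]
  have "bij_betw (compose (elts H) (fst g) (fst f)) (St H x) (St L (snd g (snd f x)))"
    if x: "x \<in> objs H" for x
  proof -
    have "bij_betw (fst g \<circ> fst f) (St H x) (St L (snd g (snd f x)))"
      using f g x fD(2)[OF x] by (intro bij_betw_trans) (auto simp: covering_morphism_def)
    moreover have "compose (elts H) (fst g) (fst f) a = (fst g \<circ> fst f) a" if "a \<in> St H x" for a
      using that by (auto simp: compose_def St_def)
    ultimately show ?thesis
      using bij_betw_cong by blast
  qed
  then show ?thesis
    using groupoidD[OF H] by (auto simp: covering_morphism_def groupoid_morphism_def compose_def fD gD)
qed

lemma internal_cover_id:
  assumes "groups_with_operations T" "internal_groupoid T H"
  shows "internal_cover T H H (restrict (\<lambda>a. a) (elts H), restrict (\<lambda>x. x) (objs H))"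
proof -
  note D = internal_groupoidD[OF assms(2)]
  show ?thesis
    using covering_morphism_id[OF D(1)] C_morphism_id[OF assms(1) D(3)] C_morphism_id[OF assms(1) D(5)]
    by (simp add: internal_cover_def internal_morphism_def covering_morphism_def D(2,4))
qed

lemma internal_cover_compose:
  assumes C: "groups_with_operations T" and H: "internal_groupoid T H"
    and f: "internal_cover T H K f" and g: "internal_cover T K L g"
  shows "internal_cover T H L (compose (elts H) (fst g) (fst f), compose (objs H) (snd g) (snd f))"
proof -
  note D = internal_groupoidD[OF H]
  show ?thesis
    using covering_morphism_compose[OF D(1), of K f L g] f g
      C_morphism_compose[OF C D(3), of "elt_alg K" "fst f" "elt_alg L" "fst g"]
      C_morphism_compose[OF C D(5), of "obj_alg K" "snd f" "obj_alg L" "snd g"]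
    by (simp add: internal_cover_def internal_morphism_def covering_morphism_def D(2,4))
qed

lemma internal_coverD:
  assumes "internal_cover T H G p"
  shows "groupoid_morphism H G p" "C_morphism T (elt_alg H) (elt_alg G) (fst p)"
    "C_morphism T (obj_alg H) (obj_alg G) (snd p)"
    "x \<in> objs H \<Longrightarrow> bij_betw (fst p) (St H x) (St G (snd p x))"
  using assms by (auto simp: internal_cover_def internal_morphism_def covering_morphism_def)

lemma category_Cov:
  assumes C: "groups_with_operations T"
  shows "category (Cov T G)"
proof -
  note mor = groupoid_morphismD[OF internal_coverD(1)]
  show ?thesis
    unfolding category_def
  proof (intro conjI ballI, goal_cases)
    case (1 P)
    then show ?case
      by (auto simp: Cov_def internal_cover_id[OF C])
  next
    case (2 P Q R f g)
    then show ?case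
      by (auto simp: Cov_def internal_cover_compose[OF C] compose_eq mor)
  next
    case (3 P Q f)
    then show ?case
      by (cases f) (auto simp: Cov_def compose_def extensional_def fun_eq_iff)
  next
    case (4 P Q f)
    then have "internal_cover T (ctotal P) (ctotal Q) f"
      by (simp add: Cov_def)
    note mor[OF this]
    with 4 show ?case
      by (cases f) (auto simp: Cov_def compose_def extensional_def fun_eq_iff)
  next
    case (5 P Q R S f g h)
    then have "internal_cover T (ctotal P) (ctotal Q) f"
      by (simp add: Cov_def)
    note mor[OF this]
    with 5 show ?case
      by (auto simp: Cov_def compose_def fun_eq_iff)
  qed
qed

section \<open>Unique lifting along covers\<close>

lemma cover_lift_unique:
  assumes "internal_groupoid T H" "internal_cover T H G p"
    and "a \<in> elts H" "b \<in> elts H" "d0 H a = d0 H b" "fst p a = fst p b"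
  shows "a = b"
proof -
  have "d0 H b \<in> objs H"
    using groupoidD(1)[OF internal_groupoidD(1)[OF assms(1)] assms(4)] .
  then have "inj_on (fst p) (St H (d0 H b))"
    using internal_coverD(4)[OF assms(2)] by (auto simp: bij_betw_def)
  then show ?thesis
    using assms by (auto simp: inj_on_def St_def)
qed

definition lift :: "('u, 'f) cover \<Rightarrow> 'u \<Rightarrow> 'u \<Rightarrow> 'u" where
  "lift P x a = (THE e. e \<in> elts (ctotal P) \<and> d0 (ctotal P) e = x \<and> fst (cmap P) e = a)"

lemma Ob_CovD:
  assumes "P \<in> Ob (Cov T G)"
  shows "internal_groupoid T (ctotal P)" "internal_cover T (ctotal P) G (cmap P)"
  using assms by (auto simp: Cov_def)

lemma lift_eqI:
  assumes P: "P \<in> Ob (Cov T G)"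
    and e: "e \<in> elts (ctotal P)" "d0 (ctotal P) e = x" "fst (cmap P) e = a"
  shows "lift P x a = e"
  unfolding lift_def
  using e cover_lift_unique[OF Ob_CovD[OF P]] by (intro the_equality) auto

lemma lift_props:
  assumes P: "P \<in> Ob (Cov T G)"
    and x: "x \<in> objs (ctotal P)" and a: "a \<in> elts G" "snd (cmap P) x = d0 G a"
  shows "lift P x a \<in> elts (ctotal P)" "d0 (ctotal P) (lift P x a) = x"
    "fst (cmap P) (lift P x a) = a"
proof -
  have "a \<in> fst (cmap P) ` St (ctotal P) x"
    using internal_coverD(4)[OF Ob_CovD(2)[OF P] x] a by (simp add: bij_betw_def St_def)
  then obtain e where e: "e \<in> elts (ctotal P)" "d0 (ctotal P) e = x" "fst (cmap P) e = a"
    by (auto simp: St_def)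
  with lift_eqI[OF P e]
  show "lift P x a \<in> elts (ctotal P)" "d0 (ctotal P) (lift P x a) = x"
    "fst (cmap P) (lift P x a) = a"
    by simp_all
qed

text \<open>On stars, \<open>p\<close> is \<open>f\<close> followed by \<open>q\<close>, and a factor of a bijection whose other factor is a bijection
  is itself one. So a morphism over \<open>G\<close> between covers of \<open>G\<close> is automatically a cover.\<close>

lemma cover_cancel:
  assumes f: "groupoid_morphism H K f" and p: "covering_morphism H G p" and q: "covering_morphism K G q"
    and e: "\<And>a. a \<in> elts H \<Longrightarrow> fst q (fst f a) = fst p a"
    and o: "\<And>x. x \<in> objs H \<Longrightarrow> snd q (snd f x) = snd p x"
  shows "covering_morphism H K f"
proof -
  have "bij_betw (fst f) (St H x) (St K (snd f x))" if x: "x \<in> objs H" for x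
  proof -
    have fx: "snd f x \<in> objs K"
      using groupoid_morphismD(2)[OF f x] .
    have into: "fst f ` St H x \<subseteq> St K (snd f x)"
      using groupoid_morphismD[OF f] by (auto simp: St_def)
    have bq: "bij_betw (fst q) (St K (snd f x)) (St G (snd p x))"
      using q fx o[OF x] by (auto simp: covering_morphism_def)
    have bp: "bij_betw (fst p) (St H x) (St G (snd p x))"
      using p x by (auto simp: covering_morphism_def)
    have "bij_betw (fst q \<circ> fst f) (St H x) (St G (snd p x))"
      using bp bij_betw_cong[of "St H x" "fst q \<circ> fst f" "fst p"] e by (auto simp: St_def)
    then show ?thesis
      using bij_betw_comp_iff2[OF bq into] by blast
  qed
  then show ?thesis
    using f by (simp add: covering_morphism_def)
qed

text \<open>Here \<open>f\<close> sends \<open>a\<close> to the lift of \<open>p a\<close> at \<open>f0 (d\<^sub>0 a)\<close>. Any two elements of a cover with the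
  same source and the same image in \<open>G\<close> agree, so each preservation law for \<open>f\<close> (identities,
  composites, operations) follows by comparing sources, where \<open>f0\<close> is a homomorphism, and images
  in \<open>G\<close>, where \<open>p\<close> and \<open>q\<close> are.\<close>

lemma cover_mapI:
  assumes C: "groups_with_operations T"
    and P: "P \<in> Ob (Cov T G)" and Q: "Q \<in> Ob (Cov T G)"
    and f0: "C_morphism T (obj_alg (ctotal P)) (obj_alg (ctotal Q)) f0"
    and over0: "\<And>x. x \<in> objs (ctotal P) \<Longrightarrow> snd (cmap Q) (f0 x) = snd (cmap P) x"
    and fe: "\<And>a. a \<in> elts (ctotal P) \<Longrightarrow> f a \<in> elts (ctotal Q)"
    and over: "\<And>a. a \<in> elts (ctotal P) \<Longrightarrow> fst (cmap Q) (f a) = fst (cmap P) a"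
    and src: "\<And>a. a \<in> elts (ctotal P) \<Longrightarrow> d0 (ctotal Q) (f a) = f0 (d0 (ctotal P) a)"
    and tgt: "\<And>a. a \<in> elts (ctotal P) \<Longrightarrow> d1 (ctotal Q) (f a) = f0 (d1 (ctotal P) a)"
    and ext: "f \<in> extensional (elts (ctotal P))" "f0 \<in> extensional (objs (ctotal P))"
  shows "(f, f0) \<in> Hom (Cov T G) P Q"
proof -
  let ?H = "ctotal P" and ?K = "ctotal Q" and ?p = "fst (cmap P)" and ?q = "fst (cmap Q)"
  note H = Ob_CovD(1)[OF P] and K = Ob_CovD(1)[OF Q]
  note p = Ob_CovD(2)[OF P] and q = Ob_CovD(2)[OF Q]
  note HD = internal_groupoidD[OF H] and KD = internal_groupoidD[OF K]
  note gH = groupoidD[OF HD(1)] and gK = groupoidD[OF KD(1)]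
  note pD = groupoid_morphismD[OF internal_coverD(1)[OF p]]
  note qD = groupoid_morphismD[OF internal_coverD(1)[OF q]]
  note it = C_morphism_iff[OF C]
  have f0_in: "f0 x \<in> objs ?K" if "x \<in> objs ?H" for x
    using f0 that by (auto simp: C_morphism_def HD(4) KD(4))
  note uniq = cover_lift_unique[OF K q]
  have gm: "groupoid_morphism ?H ?K (f, f0)"
    unfolding groupoid_morphism_def
  proof (intro conjI ballI impI, goal_cases)
    case (5 x)
    then show ?case
      by - (rule uniq, auto simp: fe gH gK f0_in src over pD qD over0)
  next
    case (6 a b)
    then have "f a \<in> elts ?K" "f b \<in> elts ?K" "d1 ?K (f a) = d0 ?K (f b)"
      by (auto simp: fe src tgt)
    with 6 show ?case
      by - (rule uniq, auto simp: fe gH gK src over pD qD)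
  qed (auto simp: fe f0_in src tgt)
  have "C_morphism T (elt_alg ?H) (elt_alg ?K) f"
    unfolding it
  proof (intro conjI ballI, goal_cases)
    case 1
    then show ?case by (auto simp: HD(2) KD(2) fe)
  next
    case (2 w a)
    then have w: "w \<in> Om1 T" and a: "a \<in> elts ?H" and fa: "f a \<in> elts ?K"
      by (auto simp: Om1'_def HD(2) fe)
    have wa: "op1 (elt_alg ?H) w a \<in> elts ?H" and wf: "op1 (elt_alg ?K) w (f a) \<in> elts ?K"
      using C_object_closed(2)[OF HD(3) w] C_object_closed(2)[OF KD(3) w] a fa HD(2) KD(2) by auto
    show ?case
    proof (rule uniq[OF fe[OF wa] wf])
      show "d0 ?K (f (op1 (elt_alg ?H) w a)) = d0 ?K (op1 (elt_alg ?K) w (f a))"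
        using 2 f0 HD(6) KD(6) a fa gH(1)[OF a] src[OF a] src[OF wa] by (simp add: it HD(2,4) KD(2,4))
      show "?q (f (op1 (elt_alg ?H) w a)) = ?q (op1 (elt_alg ?K) w (f a))"
        using 2 internal_coverD(2)[OF p] internal_coverD(2)[OF q] a fa over[OF a] over[OF wa]
        by (simp add: it HD(2,4) KD(2,4))
    qed
  next
    case (3 m a b)
    then have m: "m \<in> Om2 T" and a: "a \<in> elts ?H" "b \<in> elts ?H" and fa: "f a \<in> elts ?K" "f b \<in> elts ?K"
      by (auto simp: HD(2) fe)
    have ab: "op2 (elt_alg ?H) m a b \<in> elts ?H" and fab: "op2 (elt_alg ?K) m (f a) (f b) \<in> elts ?K"
      using C_object_closed(3)[OF HD(3) m] C_object_closed(3)[OF KD(3) m] a fa HD(2) KD(2) by auto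
    show ?case
    proof (rule uniq[OF fe[OF ab] fab])
      show "d0 ?K (f (op2 (elt_alg ?H) m a b)) = d0 ?K (op2 (elt_alg ?K) m (f a) (f b))"
        using m f0 HD(6) KD(6) a fa gH(1) src src[OF ab] by (simp add: it HD(2,4) KD(2,4))
      show "?q (f (op2 (elt_alg ?H) m a b)) = ?q (op2 (elt_alg ?K) m (f a) (f b))"
        using m internal_coverD(2)[OF p] internal_coverD(2)[OF q] a fa over over[OF ab]
        by (simp add: it HD(2,4) KD(2,4))
    qed
  qed
  moreover have "covering_morphism ?H ?K (f, f0)"
    using p q over over0
    by (intro cover_cancel[OF gm, of G "cmap P" "cmap Q"]) (auto simp: internal_cover_def)
  ultimately show ?thesis
    using gm f0 over over0 ext by (simp add: Cov_def internal_cover_def internal_morphism_def)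
qed

section \<open>The action of a cover on its objects\<close>

definition action_of_cover :: "('u, 'f) cover \<Rightarrow> ('u, 'f) action" where
  "action_of_cover P =
     \<lparr> aobj = obj_alg (ctotal P), atheta = snd (cmap P),
       aphi = (\<lambda>x a. d1 (ctotal P) (lift P x a)) \<rparr>"

text \<open>Every law of the action is an equation between end points of lifts, obtained by guessing the
  lift: the lift of \<open>a \<circ> b\<close> is the composite of the lift of \<open>a\<close> with the lift of \<open>b\<close> at its end
  point, the lift of an identity is an identity, and the lift of a sum or product is the sum or
  product of the lifts.\<close>

lemma action_of_cover_Ob:
  assumes C: "groups_with_operations T" and G: "internal_groupoid T G" and P: "P \<in> Ob (Cov T G)"
  shows "action_of_cover P \<in> Ob (Act T G)"
proof -
  let ?H = "ctotal P" and ?p = "fst (cmap P)" and ?th = "snd (cmap P)"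
  note H = Ob_CovD(1)[OF P] and p = Ob_CovD(2)[OF P]
  note HD = internal_groupoidD[OF H] and GD = internal_groupoidD[OF G]
  note gH = groupoidD[OF HD(1)] and gG = groupoidD[OF GD(1)]
  note pD = groupoid_morphismD[OF internal_coverD(1)[OF p]]
  note it = C_morphism_iff[OF C] and L = lift_props[OF P]
  have act: "groupoid_action G (objs ?H) ?th (\<lambda>x a. d1 ?H (lift P x a))"
    unfolding groupoid_action_def
  proof (intro conjI ballI impI, goal_cases)
    case (3 x a)
    then show ?case using L[of x a] pD(4)[of "lift P x a"] by simp
  next
    case (4 x a b)
    let ?e = "lift P x a" and ?y = "d1 ?H (lift P x a)"
    have e: "?e \<in> elts ?H" "d0 ?H ?e = x" "?p ?e = a"
      using L 4 by auto
    have y: "?y \<in> objs ?H" "?th ?y = d0 G b"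
      using e 4 gH(2) pD(4)[of ?e] by auto
    have e': "lift P ?y b \<in> elts ?H" "d0 ?H (lift P ?y b) = ?y" "?p (lift P ?y b) = b"
      using L y 4 by auto
    have "lift P x (comp G a b) = comp ?H ?e (lift P ?y b)"
      using e e' by - (rule lift_eqI[OF P], auto simp: gH pD)
    then show ?case
      using e e' gH by simp
  next
    case (5 x)
    then have "lift P x (eps G (?th x)) = eps ?H x"
      by - (rule lift_eqI[OF P], auto simp: gH pD)
    with 5 show ?case by (simp add: gH)
  qed (auto simp: pD gH L)
  have "C_morphism T (pullback (obj_alg ?H) ?th (elt_alg G) (d0 G)) (obj_alg ?H)
       (\<lambda>(x, a). d1 ?H (lift P x a))"
  proof (rule C_morphism_pullbackI[OF C], unfold GD(2) HD(4))
    fix x a assume x: "x \<in> objs ?H" and a: "a \<in> elts G" and xa: "?th x = d0 G a"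
    note e = L[OF x a xa]
    show "d1 ?H (lift P x a) \<in> objs ?H" using e gH by simp
    {
      fix w assume w: "w \<in> Om1' T"
      then have w': "w \<in> Om1 T" by (auto simp: Om1'_def)
      have "lift P (op1 (obj_alg ?H) w x) (op1 (elt_alg G) w a) = op1 (elt_alg ?H) w (lift P x a)"
        using e x a xa w HD(6) internal_coverD(2)[OF p] C_object_closed(2)[OF HD(3) w']
        by - (rule lift_eqI[OF P], auto simp: it HD(2,4) GD(2,4))
      then show "d1 ?H (lift P (op1 (obj_alg ?H) w x) (op1 (elt_alg G) w a)) =
          op1 (obj_alg ?H) w (d1 ?H (lift P x a))"
        using HD(7) w e by (simp add: it HD(2,4))
    }
    fix m y b assume m: "m \<in> Om2 T" and y: "y \<in> objs ?H" and b: "b \<in> elts G" and yb: "?th y = d0 G b"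
    note e' = L[OF y b yb]
    have "lift P (op2 (obj_alg ?H) m x y) (op2 (elt_alg G) m a b) =
        op2 (elt_alg ?H) m (lift P x a) (lift P y b)"
      using e e' m HD(6) internal_coverD(2)[OF p] C_object_closed(3)[OF HD(3) m]
      by - (rule lift_eqI[OF P], auto simp: it HD(2,4) GD(2,4))
    then show "d1 ?H (lift P (op2 (obj_alg ?H) m x y) (op2 (elt_alg G) m a b)) =
        op2 (obj_alg ?H) m (d1 ?H (lift P x a)) (d1 ?H (lift P y b))"
      using HD(7) m e e' by (simp add: it HD(2,4))
  qed
  with act show ?thesis
    using HD(5) internal_coverD(3)[OF p]
    by (simp add: Act_def internal_action_def action_of_cover_def HD(4))
qed

text \<open>A morphism of covers carries the lift of \<open>a\<close> at \<open>x\<close> to the lift of \<open>a\<close> at the image of \<open>x\<close>,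
  so on objects it is equivariant.\<close>

lemma action_of_cover_Hom:
  assumes P: "P \<in> Ob (Cov T G)" and Q: "Q \<in> Ob (Cov T G)" and f: "f \<in> Hom (Cov T G) P Q"
  shows "snd f \<in> Hom (Act T G) (action_of_cover P) (action_of_cover Q)"
proof -
  have f': "internal_cover T (ctotal P) (ctotal Q) f"
    and ov: "\<And>a. a \<in> elts (ctotal P) \<Longrightarrow> fst (cmap Q) (fst f a) = fst (cmap P) a"
    "\<And>x. x \<in> objs (ctotal P) \<Longrightarrow> snd (cmap Q) (snd f x) = snd (cmap P) x"
    and ext: "snd f \<in> extensional (objs (ctotal P))"
    using f by (auto simp: Cov_def)
  note fD = groupoid_morphismD[OF internal_coverD(1)[OF f']]
  have "snd f (d1 (ctotal P) (lift P x a)) = d1 (ctotal Q) (lift Q (snd f x) a)"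
    if "x \<in> objs (ctotal P)" "a \<in> elts G" "snd (cmap P) x = d0 G a" for x a
  proof -
    note e = lift_props[OF P that]
    have "lift Q (snd f x) a = fst f (lift P x a)"
      using e fD ov by - (rule lift_eqI[OF Q], auto)
    then show ?thesis using fD(4)[OF e(1)] by simp
  qed
  then show ?thesis
    using internal_coverD(3)[OF f'] ov ext internal_groupoidD(4)[OF Ob_CovD(1)[OF P]]
    by (auto simp: Act_def action_of_cover_def)
qed

section \<open>The cover of an action\<close>

text \<open>The maps \<open>pair\<close>, \<open>left\<close>, \<open>right\<close> identify \<open>'u \<times> 'u\<close> with \<open>'u\<close>. Asking for a
  bijection, rather than just an injection of pairs, makes any two elements of \<open>'u\<close> equal as soon
  as their components are, with no side condition that they be codes.\<close>

locale paired_internal_groupoid =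
  fixes T :: "'f presentation" and G :: "('u, 'f) igroupoid"
    and pair :: "'u \<Rightarrow> 'u \<Rightarrow> 'u" and left right :: "'u \<Rightarrow> 'u"
  assumes C: "groups_with_operations T"
    and G: "internal_groupoid T G"
    and left_pair [simp]: "left (pair x a) = x"
    and right_pair [simp]: "right (pair x a) = a"
    and pair_left_right [simp]: "pair (left u) (right u) = u"
begin

lemma pair_eq_iff: "u = v \<longleftrightarrow> left u = left v \<and> right u = right v"
  by (metis pair_left_right)

text \<open>The pullback of \<open>f\<close> and \<open>g\<close>, transported along the coding of pairs.\<close>

definition pullback_code ::
  "('f, 'u) algebra \<Rightarrow> ('u \<Rightarrow> 'c) \<Rightarrow> ('f, 'u) algebra \<Rightarrow> ('u \<Rightarrow> 'c) \<Rightarrow> ('f, 'u) algebra" where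
  "pullback_code A f B g =
     \<lparr> carr = {u. left u \<in> carr A \<and> right u \<in> carr B \<and> f (left u) = g (right u)},
       op0 = (\<lambda>c. pair (op0 A c) (op0 B c)),
       op1 = (\<lambda>w u. pair (op1 A w (left u)) (op1 B w (right u))),
       op2 = (\<lambda>m u v. pair (op2 A m (left u) (left v)) (op2 B m (right u) (right v))) \<rparr>"

lemma trm_val_pullback_code:
  "left (trm_val (pullback_code A f B g) v t) = trm_val A (left \<circ> v) t"
  "right (trm_val (pullback_code A f B g) v t) = trm_val B (right \<circ> v) t"
  by (induction t) (auto simp: pullback_code_def)

text \<open>Identities hold because they hold in both components. Closure needs \<open>f\<close> and \<open>g\<close> to respect
  all operations, including zero and negation.\<close>

lemma C_object_pullback_code:
  assumes A: "C_object T A" and B: "C_object T B" and D: "C_object T D"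
    and f: "C_morphism T A D f" and g: "C_morphism T B D g"
  shows "C_object T (pullback_code A f B g)"
proof -
  note fp = C_morphism_preserves[OF C A D f] and gp = C_morphism_preserves[OF C B D g]
  note cl = C_object_closed[OF A] C_object_closed[OF B]
  have "trm_val (pullback_code A f B g) v s = trm_val (pullback_code A f B g) v t"
    if st: "(s, t) \<in> Eqs T" and v: "range v \<subseteq> carr (pullback_code A f B g)" for s t v
  proof -
    have "range (left \<circ> v) \<subseteq> carr A" "range (right \<circ> v) \<subseteq> carr B"
      using v by (auto simp: pullback_code_def)
    then show ?thesis
      using C_object_identity[OF A st] C_object_identity[OF B st]
      by (simp add: pair_eq_iff[of "trm_val _ _ s"] trm_val_pullback_code)
  qed
  moreover have "op0 (pullback_code A f B g) c \<in> carr (pullback_code A f B g)" if "c \<in> Om0 T" for c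
    using that by (simp add: pullback_code_def fp gp cl)
  moreover have "op1 (pullback_code A f B g) w a \<in> carr (pullback_code A f B g)"
    if "w \<in> Om1 T" "a \<in> carr (pullback_code A f B g)" for w a
    using that by (simp add: pullback_code_def fp gp cl)
  moreover have "op2 (pullback_code A f B g) m a b \<in> carr (pullback_code A f B g)"
    if "m \<in> Om2 T" "a \<in> carr (pullback_code A f B g)" "b \<in> carr (pullback_code A f B g)" for m a b
    using that by (simp add: pullback_code_def fp gp cl)
  ultimately show ?thesis
    unfolding C_object_def by blast
qed

text \<open>The action groupoid of \<open>X\<close>: an element codes a pair \<open>(x, a)\<close> with \<open>\<theta> x = d\<^sub>0 a\<close>, viewed as an
  arrow from \<open>x\<close> to \<open>x a\<close>.\<close>

definition cover_of_action :: "('u, 'f) action \<Rightarrow> ('u, 'f) cover" where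
  "cover_of_action X =
     \<lparr> ctotal =
         \<lparr> elts = {u. left u \<in> carr (aobj X) \<and> right u \<in> elts G \<and> atheta X (left u) = d0 G (right u)},
           objs = carr (aobj X),
           d0 = left,
           d1 = (\<lambda>u. aphi X (left u) (right u)),
           eps = (\<lambda>x. pair x (eps G (atheta X x))),
           comp = (\<lambda>u v. pair (left u) (comp G (right u) (right v))),
           elt_alg = pullback_code (aobj X) (atheta X) (elt_alg G) (d0 G),
           obj_alg = aobj X \<rparr>,
       cmap = (right, atheta X) \<rparr>"

lemmas GD = internal_groupoidD[OF G] and gG = groupoidD[OF internal_groupoidD(1)[OF G]]

lemma Ob_ActD:
  assumes "X \<in> Ob (Act T G)"
  shows "C_object T (aobj X)" "groupoid_action G (carr (aobj X)) (atheta X) (aphi X)"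
    "C_morphism T (aobj X) (obj_alg G) (atheta X)"
    "C_morphism T (pullback (aobj X) (atheta X) (elt_alg G) (d0 G)) (aobj X) (\<lambda>(x, a). aphi X x a)"
  using assms by (auto simp: Act_def internal_action_def)

text \<open>The second component of each groupoid law is the law in \<open>G\<close>, while the first component and the
  end points use the axioms of an action. Likewise each homomorphism condition splits into one for \<open>X\<close> or
  the action map and one for \<open>G\<close>.\<close>

lemma cover_of_action_Ob:
  assumes X: "X \<in> Ob (Act T G)"
  shows "cover_of_action X \<in> Ob (Cov T G)"
proof -
  let ?P = "cover_of_action X"
  let ?H = "ctotal ?P"
  note XD = Ob_ActD[OF X]
  note act = groupoid_actionD[OF XD(2)]
  note it = C_morphism_iff[OF C]
  note clX = C_object_closed[OF XD(1)] and clE = C_object_closed[OF GD(3)]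
  note phi = C_morphism_pullbackD[OF C XD(4), unfolded GD(2)]
  note cmp = C_morphism_pullbackD[OF C GD(9), unfolded GD(2)]
  have sel: "elts ?H = {u. left u \<in> carr (aobj X) \<and> right u \<in> elts G \<and>
        atheta X (left u) = d0 G (right u)}"
    "objs ?H = carr (aobj X)" "d0 ?H = left" "d1 ?H = (\<lambda>u. aphi X (left u) (right u))"
    "eps ?H = (\<lambda>x. pair x (eps G (atheta X x)))"
    "comp ?H = (\<lambda>u v. pair (left u) (comp G (right u) (right v)))"
    "elt_alg ?H = pullback_code (aobj X) (atheta X) (elt_alg G) (d0 G)"
    "obj_alg ?H = aobj X" "cmap ?P = (right, atheta X)"
    by (simp_all add: cover_of_action_def)
  have alg: "carr (elt_alg ?H) = elts ?H"
    "op1 (elt_alg ?H) = (\<lambda>w u. pair (op1 (aobj X) w (left u)) (op1 (elt_alg G) w (right u)))"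
    "op2 (elt_alg ?H) = (\<lambda>m u v. pair (op2 (aobj X) m (left u) (left v))
        (op2 (elt_alg G) m (right u) (right v)))"
    by (simp_all add: sel pullback_code_def GD(2))
  have eobj: "C_object T (elt_alg ?H)"
    unfolding sel by (rule C_object_pullback_code[OF XD(1) GD(3) GD(5) XD(3) GD(6)])
  \<comment> \<open>The inverse of \<open>(x, a)\<close> is \<open>(x a, a\<^sup>-\<^sup>1)\<close>, which ends at \<open>(x a) a\<^sup>-\<^sup>1 = x\<close>.\<close>
  have inverse: "\<exists>v\<in>elts ?H. d0 ?H v = d1 ?H u \<and> d1 ?H v = d0 ?H u \<and>
        comp ?H u v = eps ?H (d0 ?H u) \<and> comp ?H v u = eps ?H (d1 ?H u)" if u: "u \<in> elts ?H" for u
  proof -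
    have u': "left u \<in> carr (aobj X)" "right u \<in> elts G" "atheta X (left u) = d0 G (right u)"
      using u by (auto simp: sel)
    obtain b where b: "b \<in> elts G" "d0 G b = d1 G (right u)" "d1 G b = d0 G (right u)"
      "comp G (right u) b = eps G (d0 G (right u))" "comp G b (right u) = eps G (d1 G (right u))"
      using gG(12)[OF u'(2)] by blast
    have "aphi X (aphi X (left u) (right u)) b = left u"
      using act(4)[OF u'(1,2) b(1) u'(3) b(2)[symmetric]] act(5)[OF u'(1)] b u' by simp
    with b u' show ?thesis
      by (intro bexI[of _ "pair (aphi X (left u) (right u)) b"]) (auto simp: sel act)
  qed
  have grp: "is_groupoid ?H"
    unfolding is_groupoid_def
  proof (intro conjI ballI impI, goal_cases)
    \<comment> \<open>Composable arrows of the action groupoid have composable second components, since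
      \<open>\<theta> (x a) = d\<^sub>1 a\<close>; this is used for all laws that involve composition.\<close>
    case (9 a b c)
    then have "d1 G (right a) = d0 G (right b)" "d1 G (right b) = d0 G (right c)"
      using act(3)[of "left a" "right a"] act(3)[of "left b" "right b"] by (auto simp: sel)
    with 9 show ?case by (auto simp: sel gG)
  next
    case (12 a)
    then show ?case by (rule inverse)
  next
    case (6 a b)
    then have "d1 G (right a) = d0 G (right b)"
      using act(3)[of "left a" "right a"] by (auto simp: sel)
    with 6 show ?case by (auto simp: sel gG)
  next
    case (8 a b)
    then have "d1 G (right a) = d0 G (right b)"
      using act(3)[of "left a" "right a"] by (auto simp: sel)
    with 8 show ?case by (auto simp: sel gG act)
  next
    case (11 a)
    then have "atheta X (d1 ?H a) = d1 G (right a)"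
      using act(3)[of "left a" "right a"] by (auto simp: sel)
    with 11 show ?case by (auto simp: sel gG)
  next
    case (10 a)
    then show ?case using gG(10)[of "right a"] by (auto simp: sel)
  qed (auto simp: sel act gG)
  have int: "internal_groupoid T ?H"
    unfolding internal_groupoid_def
  proof (intro conjI grp eobj alg)
    show "carr (obj_alg ?H) = objs ?H" "C_object T (obj_alg ?H)"
      by (simp_all add: sel XD)
    show "C_morphism T (elt_alg ?H) (obj_alg ?H) (d0 ?H)"
      unfolding it alg by (auto simp: sel)
    show "C_morphism T (elt_alg ?H) (obj_alg ?H) (d1 ?H)"
      unfolding it alg by (auto simp: sel act phi)
    show "C_morphism T (obj_alg ?H) (elt_alg ?H) (eps ?H)"
      using XD(3) GD(8) unfolding it alg by (auto simp: sel act gG GD(2,4) Pi_iff)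
    show "C_morphism T (pullback (elt_alg ?H) (d1 ?H) (elt_alg ?H) (d0 ?H)) (elt_alg ?H)
       (\<lambda>(a, b). comp ?H a b)"
    proof (rule C_morphism_pullbackI[OF C], unfold alg(1))
      fix u v assume u: "u \<in> elts ?H" and v: "v \<in> elts ?H" and uv: "d1 ?H u = d0 ?H v"
      show "comp ?H u v \<in> elts ?H"
        using grp u v uv by (auto simp: groupoidD)
      have uv': "d1 G (right u) = d0 G (right v)"
        using act(3)[of "left u" "right u"] u v uv by (auto simp: sel)
      {
        fix w assume "w \<in> Om1' T"
        then show "comp ?H (op1 (elt_alg ?H) w u) (op1 (elt_alg ?H) w v) =
            op1 (elt_alg ?H) w (comp ?H u v)"
          using u v uv' unfolding alg by (auto simp: sel cmp)
      }
      fix m u' v' assume m: "m \<in> Om2 T" and u': "u' \<in> elts ?H" and v': "v' \<in> elts ?H"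
        and "d1 ?H u' = d0 ?H v'"
      then have "d1 G (right u') = d0 G (right v')"
        using act(3)[of "left u'" "right u'"] by (auto simp: sel)
      then show "comp ?H (op2 (elt_alg ?H) m u u') (op2 (elt_alg ?H) m v v') =
          op2 (elt_alg ?H) m (comp ?H u v) (comp ?H u' v')"
        using m u v u' v' uv' unfolding alg by (auto simp: sel cmp)
    qed
  qed
  have gm: "groupoid_morphism ?H G (cmap ?P)"
    unfolding groupoid_morphism_def by (auto simp: sel act)
  moreover have "C_morphism T (elt_alg ?H) (elt_alg G) (fst (cmap ?P))"
    unfolding it alg by (auto simp: sel GD(2))
  moreover have "bij_betw (fst (cmap ?P)) (St ?H x) (St G (snd (cmap ?P) x))"
    if "x \<in> objs ?H" for x
    using that
    by (intro bij_betwI[where g = "pair x"]) (auto simp: sel St_def)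
  ultimately have "internal_cover T ?H G (cmap ?P)"
    using XD(3) by (simp add: internal_cover_def internal_morphism_def covering_morphism_def sel)
  with int show ?thesis
    by (simp add: Cov_def)
qed

definition cover_map_of_action_map :: "('u, 'f) action \<Rightarrow> ('u \<Rightarrow> 'u) \<Rightarrow> 'u gmap" where
  "cover_map_of_action_map X f =
     (restrict (\<lambda>u. pair (f (left u)) (right u)) (elts (ctotal (cover_of_action X))), f)"

lemma cover_of_action_Hom:
  assumes X: "X \<in> Ob (Act T G)" and Y: "Y \<in> Ob (Act T G)" and f: "f \<in> Hom (Act T G) X Y"
  shows "cover_map_of_action_map X f \<in> Hom (Cov T G) (cover_of_action X) (cover_of_action Y)"
  unfolding cover_map_of_action_map_def
  by (rule cover_mapI[OF C cover_of_action_Ob[OF X] cover_of_action_Ob[OF Y]])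
    (use f in \<open>auto simp: Act_def cover_of_action_def C_morphism_def Pi_iff\<close>)

lemma cover_of_action_functor:
  "is_functor (Act T G) (Cov T G) cover_of_action (\<lambda>X Y. cover_map_of_action_map X)"
  unfolding is_functor_def
proof (intro conjI ballI, goal_cases)
  case (3 X)
  then show ?case
    by (auto simp: Act_def Cov_def cover_map_of_action_map_def cover_of_action_def fun_eq_iff)
next
  case (4 X Y Z f g)
  then show ?case
    by (auto simp: Act_def Cov_def cover_map_of_action_map_def cover_of_action_def fun_eq_iff
        compose_def C_morphism_def Pi_iff)
qed (auto simp: cover_of_action_Ob cover_of_action_Hom)

lemma action_of_cover_functor:
  "is_functor (Cov T G) (Act T G) action_of_cover (\<lambda>P Q. snd)"
  unfolding is_functor_def
proof (intro conjI ballI, goal_cases)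
  case (3 P)
  then show ?case
    by (auto simp: Act_def Cov_def action_of_cover_def internal_groupoidD(4))
next
  case (4 P Q R f g)
  then show ?case
    by (auto simp: Act_def Cov_def action_of_cover_def internal_groupoidD(4))
qed (auto simp: action_of_cover_Ob[OF C G] action_of_cover_Hom)

section \<open>The two constructions are mutually inverse\<close>

text \<open>The lift of \<open>a\<close> at \<open>x\<close> to the action groupoid is the pair \<open>(x, a)\<close>, which ends at \<open>x a\<close>. Outside
  the pullback the two action maps may differ, so the records need not be equal.\<close>

lemma action_of_cover_of_action:
  assumes X: "X \<in> Ob (Act T G)"
  defines "Z \<equiv> action_of_cover (cover_of_action X)"
  shows "aobj Z = aobj X" "atheta Z = atheta X"
    "x \<in> carr (aobj X) \<Longrightarrow> a \<in> elts G \<Longrightarrow> atheta X x = d0 G a \<Longrightarrow> aphi Z x a = aphi X x a"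
proof -
  show "aobj Z = aobj X" "atheta Z = atheta X"
    by (simp_all add: Z_def action_of_cover_def cover_of_action_def)
  show "aphi Z x a = aphi X x a" if "x \<in> carr (aobj X)" "a \<in> elts G" "atheta X x = d0 G a"
  proof -
    have "lift (cover_of_action X) x a = pair x a"
      using that by - (rule lift_eqI[OF cover_of_action_Ob[OF X]], auto simp: cover_of_action_def)
    then show ?thesis
      by (simp add: Z_def action_of_cover_def cover_of_action_def)
  qed
qed

lemma unit_natural_iso:
  "natural_iso (Act T G) (Act T G) (\<lambda>X. X) (\<lambda>X Y f. f)
     (\<lambda>X. action_of_cover (cover_of_action X)) (\<lambda>X Y f. snd (cover_map_of_action_map X f))
     (\<lambda>X. restrict (\<lambda>x. x) (carr (aobj X)))"
  unfolding natural_iso_def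
proof (intro conjI ballI, goal_cases)
  case (1 X)
  let ?Z = "action_of_cover (cover_of_action X)" and ?i = "restrict (\<lambda>x. x) (carr (aobj X))"
  note Z = action_of_cover_of_action[OF 1]
  note act = groupoid_actionD[OF Ob_ActD(2)[OF 1]]
  note id = C_morphism_id[OF C Ob_ActD(1)[OF 1]]
  have "?i \<in> Hom (Act T G) X ?Z" "?i \<in> Hom (Act T G) ?Z X"
    using id by (auto simp: Act_def Z act)
  then show ?case
    unfolding iso_arrow_def by (intro conjI bexI[of _ ?i]) (auto simp: Act_def Z compose_def fun_eq_iff)
next
  case (2 X Y f)
  then show ?case
    by (auto simp: Act_def cover_map_of_action_map_def compose_def fun_eq_iff C_morphism_def Pi_iff
        extensional_def)
qed

definition counit :: "('u, 'f) cover \<Rightarrow> 'u gmap" where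
  "counit P =
     (restrict (\<lambda>u. lift P (left u) (right u)) (elts (ctotal (cover_of_action (action_of_cover P)))),
      restrict (\<lambda>x. x) (objs (ctotal P)))"

definition counit_inv :: "('u, 'f) cover \<Rightarrow> 'u gmap" where
  "counit_inv P =
     (restrict (\<lambda>e. pair (d0 (ctotal P) e) (fst (cmap P) e)) (elts (ctotal P)),
      restrict (\<lambda>x. x) (objs (ctotal P)))"

lemma cover_of_action_of_cover:
  assumes P: "P \<in> Ob (Cov T G)"
  defines "R \<equiv> cover_of_action (action_of_cover P)"
  shows "elts (ctotal R) = {u. left u \<in> objs (ctotal P) \<and> right u \<in> elts G \<and>
           snd (cmap P) (left u) = d0 G (right u)}"
    "objs (ctotal R) = objs (ctotal P)" "obj_alg (ctotal R) = obj_alg (ctotal P)"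
    "d0 (ctotal R) = left" "d1 (ctotal R) = (\<lambda>u. d1 (ctotal P) (lift P (left u) (right u)))"
    "cmap R = (right, snd (cmap P))"
  using internal_groupoidD(4)[OF Ob_CovD(1)[OF P]]
  by (simp_all add: R_def cover_of_action_def action_of_cover_def)

text \<open>Both maps are the identity on objects and lie over \<open>G\<close>, hence are morphisms of covers by
  \<open>cover_mapI\<close>. They are mutually inverse because \<open>e\<close> is the lift of its own image at its own
  source.\<close>

lemma counit_iso:
  assumes P: "P \<in> Ob (Cov T G)"
  shows "iso_arrow (Cov T G) (cover_of_action (action_of_cover P)) P (counit P)"
proof -
  let ?R = "cover_of_action (action_of_cover P)"
  let ?H = "ctotal P"
  have R: "?R \<in> Ob (Cov T G)"
    using cover_of_action_Ob action_of_cover_Ob[OF C G P] by blast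
  note sel = cover_of_action_of_cover[OF P]
  note HD = internal_groupoidD[OF Ob_CovD(1)[OF P]]
  note gH = groupoidD[OF HD(1)]
  note pD = groupoid_morphismD[OF internal_coverD(1)[OF Ob_CovD(2)[OF P]]]
  note L = lift_props[OF P]
  have lift_id: "lift P (d0 ?H e) (fst (cmap P) e) = e" if "e \<in> elts ?H" for e
    using that by - (rule lift_eqI[OF P], auto)
  note id = C_morphism_id[OF C HD(5), unfolded HD(4)]
  have "counit P \<in> Hom (Cov T G) ?R P"
    unfolding counit_def
    by (rule cover_mapI[OF C R P]) (auto simp: sel id L gH)
  moreover have "counit_inv P \<in> Hom (Cov T G) P ?R"
    unfolding counit_inv_def
    by (rule cover_mapI[OF C P R]) (auto simp: sel id gH pD lift_id)
  moreover have "Cmp (Cov T G) ?R P ?R (counit_inv P) (counit P) = Idt (Cov T G) ?R"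
    by (auto simp: Cov_def counit_def counit_inv_def sel L fun_eq_iff compose_def)
  moreover have "Cmp (Cov T G) P ?R P (counit P) (counit_inv P) = Idt (Cov T G) P"
    by (auto simp: Cov_def counit_def counit_inv_def sel gH pD lift_id fun_eq_iff compose_def)
  ultimately show ?thesis
    unfolding iso_arrow_def by blast
qed

text \<open>Naturality on elements says that morphisms of covers commute with lifting.\<close>

lemma counit_natural_iso:
  "natural_iso (Cov T G) (Cov T G)
     (\<lambda>P. cover_of_action (action_of_cover P))
     (\<lambda>P Q f. cover_map_of_action_map (action_of_cover P) (snd f))
     (\<lambda>P. P) (\<lambda>P Q f. f) counit"
  unfolding natural_iso_def
proof (intro conjI ballI, goal_cases)
  case (1 P)
  then show ?case by (rule counit_iso)
next
  case (2 P Q f)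
  note P = 2(1) and Q = 2(2)
  have f': "internal_cover T (ctotal P) (ctotal Q) f"
    and ov: "\<And>a. a \<in> elts (ctotal P) \<Longrightarrow> fst (cmap Q) (fst f a) = fst (cmap P) a"
    "\<And>x. x \<in> objs (ctotal P) \<Longrightarrow> snd (cmap Q) (snd f x) = snd (cmap P) x"
    using 2(3) by (auto simp: Cov_def)
  note fD = groupoid_morphismD[OF internal_coverD(1)[OF f']]
  have lift_f: "lift Q (snd f x) a = fst f (lift P x a)"
    if "x \<in> objs (ctotal P)" "a \<in> elts G" "snd (cmap P) x = d0 G a" for x a
    using lift_props[OF P that] fD ov by - (rule lift_eqI[OF Q], auto)
  note sel = cover_of_action_of_cover[OF P] cover_of_action_of_cover[OF Q]
  have "compose (elts (ctotal (cover_of_action (action_of_cover P)))) (fst (counit Q))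
        (fst (cover_map_of_action_map (action_of_cover P) (snd f))) =
      compose (elts (ctotal (cover_of_action (action_of_cover P)))) (fst f) (fst (counit P))"
    by (rule ext)
      (simp add: counit_def cover_map_of_action_map_def compose_def sel fD(2) ov(2) lift_f)
  moreover have "compose (objs (ctotal P)) (snd (counit Q)) (snd f) =
      compose (objs (ctotal P)) (snd f) (snd (counit P))"
    by (rule ext) (simp add: counit_def compose_def fD(2))
  ultimately show ?case
    by (simp add: Cov_def sel(2) cover_map_of_action_map_def)
qed

lemma equivalent_Act_Cov: "equivalent_categories (Act T G) (Cov T G)"
  unfolding equivalent_categories_def
proof (intro conjI)
  show "category (Act T G)" "category (Cov T G)"
    using category_Act[OF C] category_Cov[OF C] .
  show "\<exists>Fo Fm Go Gm. is_functor (Act T G) (Cov T G) Fo Fm \<and> is_functor (Cov T G) (Act T G) Go Gm \<and>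
      (\<exists>t. natural_iso (Act T G) (Act T G) (\<lambda>x. x) (\<lambda>x y f. f)
            (\<lambda>x. Go (Fo x)) (\<lambda>x y f. Gm (Fo x) (Fo y) (Fm x y f)) t) \<and>
      (\<exists>s. natural_iso (Cov T G) (Cov T G)
            (\<lambda>x. Fo (Go x)) (\<lambda>x y f. Fm (Go x) (Go y) (Gm x y f)) (\<lambda>x. x) (\<lambda>x y f. f) s)"
    by (rule exI[of _ cover_of_action], rule exI[of _ "\<lambda>X Y. cover_map_of_action_map X"],
        rule exI[of _ action_of_cover], rule exI[of _ "\<lambda>P Q. snd"],
        intro conjI, rule cover_of_action_functor, rule action_of_cover_functor,
        rule exI, rule unit_natural_iso, rule exI, rule counit_natural_iso)
qed

end

lemma infinite_type_pairing:
  assumes "infinite (UNIV :: 'u set)"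
  obtains pair :: "'u \<Rightarrow> 'u \<Rightarrow> 'u" and left right :: "'u \<Rightarrow> 'u"
  where "\<And>x a. left (pair x a) = x" "\<And>x a. right (pair x a) = a"
    "\<And>u. pair (left u) (right u) = u"
proof -
  have "\<exists>h :: 'u \<times> 'u \<Rightarrow> 'u. bij_betw h (UNIV \<times> UNIV) UNIV"
    using card_of_Times_same_infinite[OF assms] by (simp only: card_of_ordIso)
  then obtain h :: "'u \<times> 'u \<Rightarrow> 'u" where h: "bij h"
    by auto
  show thesis
  proof (rule that)
    show "fst (inv h (h (x, a))) = x" "snd (inv h (h (x, a))) = a" for x a
      by (simp_all add: inv_f_f[OF bij_is_inj[OF h]])
    show "h (fst (inv h u), snd (inv h u)) = u" for u
      by (simp add: surj_f_inv_f[OF bij_is_surj[OF h]])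
  qed
qed

theorem theorem4p2:
  fixes T :: "'f presentation" and G :: "('u, 'f) igroupoid"
  assumes universe: "infinite (UNIV :: 'u set)"
    and C: "groups_with_operations T"
    and G: "internal_groupoid T G"
  shows "equivalent_categories (Act T G) (Cov T G)"
proof (rule infinite_type_pairing[OF universe])
  fix pair :: "'u \<Rightarrow> 'u \<Rightarrow> 'u" and left right :: "'u \<Rightarrow> 'u"
  assume "\<And>x a. left (pair x a) = x" "\<And>x a. right (pair x a) = a"
    "\<And>u. pair (left u) (right u) = u"
  then interpret paired_internal_groupoid T G pair left right
    using C G by unfold_locales
  show ?thesis
    by (rule equivalent_Act_Cov)
qed

end
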